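(* Let $K\ge 2$ and $N\ge\deg(\phi)$ be integers, let $\Delta t>0$, let $(\tilde C^i_{k,n})_{0\le k\le K,\,0\le n\le N,\,i\in\mathbb{N}}$ be the solution of the fully discrete scheme, and set $\tilde r^i:=\tilde C^i_0$, $\tilde m^i:=\tilde C^i_1$, $\tilde e^i:=\tilde C^i_2$. 1. For a general potential $\phi$: if $\langle\tilde r^0\rangle=0$, then $\langle\tilde r^i\rangle=0$ for all $i\in\mathbb{N}$. Likewise, if $\frac{1}{\sqrt2}\langle\tilde e^0\rangle+\langle\phi\tilde r^0\rangle=0$, then $\frac{1}{\sqrt2}\langle\tilde e^i\rangle+\langle\phi\tilde r^i\rangle=0$ for all $i\in\mathbb{N}$. 2. If $\phi$ is harmonic: if $\langle\tilde r^0 x\rangle=0$ and $\langle\tilde m^0\rangle=0$, then $\langle\tilde r^i x\rangle=0$ and $\langle\tilde m^i\rangle=0$ for all $i\in\mathbb{N}$. Likewise, if $\langle\tilde r^0\rangle=0$, $\langle\tilde m^0 x\rangle=0$ and $\frac{1}{\sqrt2}\langle\tilde e^0\rangle-\langle\phi\tilde r^0\rangle=0$, then $\langle\tilde r^i\rangle=0$, $\langle\tilde m^i x\rangle=0$ and $\frac{1}{\sqrt2}\langle\tilde e^i\rangle-\langle\phi\tilde r^i\rangle=0$ for all $i\in\mathbb{N}$.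
   Context: Potential. $\phi:\mathbb{R}\to\mathbb{R}$ is an even polynomial of degree $2m$, $m\ge 1$, with positive leading coefficient; $\rho:=e^{-\phi}$ and it is assumed that $\int_{\mathbb{R}}\rho\,dx=1$ and $\int_{\mathbb{R}}\phi''\rho\,dx=1$. The potential is called harmonic if $\phi(x)=\frac12(x^2+\ln(2\pi))$. Notation. $\langle f,g\rangle=\int_{\mathbb{R}} fg\rho\,dx$, $\langle f\rangle=\int_{\mathbb{R}} f\rho\,dx$. $\mu(v)=\frac{1}{\sqrt{2\pi}}e^{-v^2/2}$, $\mathcal{M}(x,v)=\mu(v)\rho(x)$. $(\tilde P_n)_{n\ge0}$ are the orthonormal polynomials for the weight $\rho$ ($\deg\tilde P_n=n$, positive leading coefficient) and $(\tilde H_k)_{k\ge0}$ the orthonormal (Hermite) polynomials for the weight $\mu$. $\delta_{k\ge3}=1$ if $k\ge3$ and $0$ otherwise. Fully discrete scheme (implicit Euler in time, time step $\Delta t>0$). Given $K,N\in\mathbb{N}$ and $h_0\in L^2(\mathbb{R}\times\mathbb{R},\mathcal{M}\,dx\,dv)$, the coefficients $\tilde C^i_{k,n}$, $0\le k\le K$, $0\le n\le N$, $i\in\mathbb{N}$, are defined by $\tilde C^0_{k,n}=\int_{\mathbb{R}\times\mathbb{R}}h_0\tilde P_n(x)\tilde H_k(v)\mathcal{M}\,dx\,dv$ and $$\tilde C^{i+1}_{k,n}=\tilde C^i_{k,n}+\Delta t\Big(\sqrt{k+1}\sum_{r=0}^N\langle\tilde P_r,\partial_x\tilde P_n\rangle\tilde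 C^{i+1}_{k+1,r}-\sqrt{k}\sum_{r=0}^N\langle\tilde P_n,\partial_x\tilde P_r\rangle\tilde C^{i+1}_{k-1,r}-\delta_{k\ge3}\tilde C^{i+1}_{k,n}\Big),$$ with $\tilde C^i_{-1,n}=\tilde C^i_{K+1,n}=0$ for all $n$ and $i$. Set $\tilde C^i_k(x)=\sum_{n=0}^N\tilde C^i_{k,n}\tilde P_n(x)$. *)

theory Defs
  imports "HOL-Probability.Distributions" "HOL-Computational_Algebra.Polynomial"
begin

definition weighted_mean :: "(real \<Rightarrow> real) \<Rightarrow> (real \<Rightarrow> real) \<Rightarrow> real" where
  "weighted_mean w f = (LBINT x. f x * w x)"

definition weighted_inner :: "(real \<Rightarrow> real) \<Rightarrow> (real \<Rightarrow> real) \<Rightarrow> (real \<Rightarrow> real) \<Rightarrow> real" where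
  "weighted_inner w f g = (LBINT x. f x * g x * w x)"

definition gibbs_density :: "real poly \<Rightarrow> real \<Rightarrow> real" where
  "gibbs_density \<phi> x = exp (- poly \<phi> x)"

(* A Bochner integral of a non-integrable function is 0, so the two normalisations below also
   say that the integrands are integrable. *)
definition admissible_potential :: "real poly \<Rightarrow> bool" where
  "admissible_potential \<phi> \<longleftrightarrow>
     (\<forall>x. poly \<phi> (- x) = poly \<phi> x) \<and>
     (\<exists>m\<ge>1. degree \<phi> = 2 * m) \<and>
     lead_coeff \<phi> > 0 \<and>
     (LBINT x. gibbs_density \<phi> x) = 1 \<and>
     (LBINT x. poly (pderiv (pderiv \<phi>)) x * gibbs_density \<phi> x) = 1"

definition harmonic_potential :: "real poly \<Rightarrow> bool" where
  "harmonic_potential \<phi> \<longleftrightarrow> (\<forall>x. poly \<phi> x = (x\<^sup>2 + ln (2 * pi)) / 2)"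

(* For a positive weight with finite moments these conditions determine P uniquely. *)
definition orthonormal_polys :: "(real \<Rightarrow> real) \<Rightarrow> (nat \<Rightarrow> real poly) \<Rightarrow> bool" where
  "orthonormal_polys w P \<longleftrightarrow>
     (\<forall>n. degree (P n) = n \<and> lead_coeff (P n) > 0) \<and>
     (\<forall>n l. weighted_inner w (poly (P n)) (poly (P l)) = (if n = l then 1 else 0))"

(* The density on phase space; std_normal_density is the weight mu in velocity. *)
definition maxwellian :: "real poly \<Rightarrow> real \<times> real \<Rightarrow> real" where
  "maxwellian \<phi> = (\<lambda>(x, v). std_normal_density v * gibbs_density \<phi> x)"

(* Every class in L^2 has a Borel measurable representative. *)
definition square_integrable_wrt :: "(real \<times> real \<Rightarrow> real) \<Rightarrow> (real \<times> real \<Rightarrow> real) \<Rightarrow> bool" where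
  "square_integrable_wrt M h \<longleftrightarrow>
     h \<in> borel_measurable borel \<and> integrable lborel (\<lambda>z. (h z)\<^sup>2 * M z)"

(* C i k n is the coefficient at time step i. The index k is an integer because the closure
   conditions prescribe the values at k = -1 and k = K + 1. No condition is put on C outside
   -1 \<le> k \<le> K + 1, n \<le> N. *)
definition fully_discrete_scheme ::
  "real poly \<Rightarrow> (nat \<Rightarrow> real poly) \<Rightarrow> (nat \<Rightarrow> real poly) \<Rightarrow> nat \<Rightarrow> nat \<Rightarrow> real
   \<Rightarrow> (real \<times> real \<Rightarrow> real) \<Rightarrow> (nat \<Rightarrow> int \<Rightarrow> nat \<Rightarrow> real) \<Rightarrow> bool" where
  "fully_discrete_scheme \<phi> P H K N \<Delta>t h0 C \<longleftrightarrow>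
     (\<forall>k\<le>K. \<forall>n\<le>N. C 0 (int k) n =
        (LINT (x, v)|lborel. h0 (x, v) * poly (P n) x * poly (H k) v * maxwellian \<phi> (x, v))) \<and>
     (\<forall>i. \<forall>n\<le>N. C i (- 1) n = 0 \<and> C i (int K + 1) n = 0) \<and>
     (\<forall>i. \<forall>k\<le>K. \<forall>n\<le>N. C (Suc i) (int k) n = C i (int k) n + \<Delta>t *
        (sqrt (real k + 1) *
           (\<Sum>r\<le>N. weighted_inner (gibbs_density \<phi>) (poly (P r)) (poly (pderiv (P n)))
                   * C (Suc i) (int k + 1) r)
         - sqrt (real k) *
           (\<Sum>r\<le>N. weighted_inner (gibbs_density \<phi>) (poly (P n)) (poly (pderiv (P r)))
                   * C (Suc i) (int k - 1) r)
         - (if k \<ge> 3 then 1 else 0) * C (Suc i) (int k) n))"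

definition hermite_coefficient ::
  "(nat \<Rightarrow> real poly) \<Rightarrow> nat \<Rightarrow> (nat \<Rightarrow> int \<Rightarrow> nat \<Rightarrow> real) \<Rightarrow> nat \<Rightarrow> int \<Rightarrow> real \<Rightarrow> real" where
  "hermite_coefficient P N C i k x = (\<Sum>n\<le>N. C i k n * poly (P n) x)"

end

theory Submission
  imports Defs
begin

text \<open>
  Write \<open>\<langle>p, q\<rangle>\<close> for the scalar product with weight \<open>\<rho> = exp (- \<phi>)\<close>, and \<open>R\<^sub>k\<close> for the polynomial with
  coefficients \<open>C k n\<close> in the basis \<open>P n\<close>. The scheme is the Galerkin projection of the Hermite system to polynomials of
  degree at most \<open>N\<close>: multiplying it by the coefficients of a polynomial \<open>q\<close> of degree at most \<open>N\<close>
  and summing gives the weak form (\<open>weak_form\<close>)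
  \<open>\<langle>R\<^sub>k\<^sup>+ - R\<^sub>k, q\<rangle> = \<Delta>t (sqrt (k + 1) \<langle>R\<^sub>k\<^sub>+\<^sub>1\<^sup>+, q'\<rangle> - sqrt k \<langle>R\<^sub>k\<^sub>-\<^sub>1\<^sup>+, \<phi>' q - q'\<rangle>)\<close> for \<open>k \<le> 2\<close>,
  where the superscript + marks the new time step and the derivative in the last term has been moved
  from \<open>R\<^sub>k\<^sub>-\<^sub>1\<^sup>+\<close> to the test polynomial by integration by parts (\<open>gibbs_mean_pderiv\<close>).
  The functionals of the statement come from the test polynomials \<open>1\<close>, \<open>x\<close> and \<open>\<phi>\<close>, which all have degree at most \<open>N\<close>.

  For a general potential, \<open>q = 1\<close> at level 0 gives conservation of mass. Level 0 tested with \<open>\<phi>\<close>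
  produces \<open>\<langle>R\<^sub>1, \<phi>'\<rangle>\<close>, and level 2 tested with \<open>1\<close> produces \<open>- sqrt 2 \<langle>R\<^sub>1, \<phi>'\<rangle>\<close>, so that
  these cancel in \<open>\<langle>R\<^sub>2, 1\<rangle> / sqrt 2 + \<langle>R\<^sub>0, \<phi>\<rangle>\<close>.

  In the harmonic case \<open>\<phi>' = x\<close> closes two further pairs of functionals: the pair
  \<open>(\<langle>R\<^sub>0, x\<rangle>, \<langle>R\<^sub>1, 1\<rangle>)\<close>, and, on the states of zero mass, the pair
  \<open>(\<langle>R\<^sub>1, x\<rangle>, \<langle>R\<^sub>2, 1\<rangle> / sqrt 2 - \<langle>R\<^sub>0, \<phi>\<rangle>)\<close>. Each pair undergoes an implicit Euler step of
  a rotation, with \<open>\<omega> = \<Delta>t\<close> for the first and \<open>\<omega> = 2 \<Delta>t\<close> for the second. This is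
  a linear system with determinant \<open>1 + \<omega>\<^sup>2 > 0\<close> for the new values, so the pair stays at zero once
  it starts there (\<open>implicit_rotation_step_zero\<close>).
\<close>

section \<open>Polynomials against the Gibbs density\<close>

text \<open>The potential has degree at least 2 and positive leading coefficient, so it exceeds \<open>x\<close> for large
  \<open>x\<close>; the Gibbs density is then below \<open>exp (- x)\<close>, which beats every power.\<close>

lemma poly_times_gibbs_density_at_top:
  assumes "admissible_potential \<phi>"
  shows "((\<lambda>x. poly p x * gibbs_density \<phi> x) \<longlongrightarrow> 0) at_top"
proof -
  from assms obtain m where m: "m \<ge> 1" "degree \<phi> = 2 * m" and lc: "lead_coeff \<phi> > 0"
    unfolding admissible_potential_def by blast
  have deg: "degree [:0, -1:] < degree \<phi>"
    using m by simp
  have "lead_coeff (\<phi> + [:0, -1:]) = lead_coeff \<phi>"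
    unfolding degree_add_eq_left[OF deg] coeff_add coeff_eq_0[OF deg] by simp
  with lc have "lead_coeff (\<phi> + [:0, -1:]) > 0"
    by simp
  then obtain n where n: "\<And>x. x \<ge> n \<Longrightarrow> poly (\<phi> + [:0, -1:]) x > 0"
    using poly_pinfty_gt_lc[of "\<phi> + [:0, -1:]"] by (meson less_le_trans)
  have monom: "((\<lambda>x. x ^ k * gibbs_density \<phi> x) \<longlongrightarrow> 0) at_top" for k
  proof (rule Lim_null_comparison[OF _ tendsto_power_div_exp_0[of k]])
    show "\<forall>\<^sub>F x in at_top. norm (x ^ k * gibbs_density \<phi> x) \<le> x ^ k / exp x"
      using eventually_ge_at_top[of "max 0 n"]
    proof eventually_elim
      case (elim x)
      then have "exp (- poly \<phi> x) \<le> exp (- x)"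
        using n[of x] by simp
      then show ?case
        using elim
        by (simp add: gibbs_density_def exp_minus abs_mult divide_inverse mult_left_mono)
    qed
  qed
  have "((\<lambda>x. \<Sum>k\<le>degree p. coeff p k * (x ^ k * gibbs_density \<phi> x))
      \<longlongrightarrow> (\<Sum>k\<le>degree p. coeff p k * 0)) at_top"
    by (intro tendsto_intros monom)
  then show ?thesis
    by (simp add: poly_altdef sum_distrib_right mult.assoc)
qed

lemma poly_times_gibbs_density_at_bot:
  assumes "admissible_potential \<phi>"
  shows "((\<lambda>x. poly p x * gibbs_density \<phi> x) \<longlongrightarrow> 0) at_bot"
proof -
  have "poly \<phi> (- x) = poly \<phi> x" for x
    using assms unfolding admissible_potential_def by blast
  then show ?thesis
    unfolding filterlim_at_bot_mirror
    using poly_times_gibbs_density_at_top[OF assms, of "pcompose p [:0, -1:]"]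
    by (simp add: poly_pcompose gibbs_density_def)
qed

text \<open>An orthonormal sequence has one member in each degree, so leading terms can be removed one at
  a time.\<close>

lemma degree_sequence_spans:
  fixes P :: "nat \<Rightarrow> 'a :: field poly"
  assumes deg: "\<And>n. degree (P n) = n" and nz: "\<And>n. P n \<noteq> 0" and "degree q \<le> N"
  obtains a where "q = (\<Sum>n\<le>N. smult (a n) (P n))"
proof -
  have "\<exists>a. q = (\<Sum>n\<le>N. smult (a n) (P n))"
    using \<open>degree q \<le> N\<close>
  proof (induction N arbitrary: q)
    case 0
    obtain c where c: "q = [:c:]"
      using 0 by (auto elim: degree_eq_zeroE)
    obtain d where d: "P 0 = [:d:]"
      using deg[of 0] by (auto elim: degree_eq_zeroE)
    have "d \<noteq> 0"
      using nz[of 0] d by auto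
    then have "q = smult (c / d) (P 0)"
      using c d by simp
    then show ?case
      by (intro exI[of _ "\<lambda>_. c / d"]) simp
  next
    case (Suc N)
    define b where "b = coeff q (Suc N) / lead_coeff (P (Suc N))"
    have lc: "coeff (P (Suc N)) (Suc N) \<noteq> 0"
      using nz[of "Suc N"] deg[of "Suc N"] by (metis leading_coeff_0_iff)
    have "degree (q - smult b (P (Suc N))) \<le> N"
    proof (rule degree_le, intro allI impI)
      fix i assume "N < i"
      show "coeff (q - smult b (P (Suc N))) i = 0"
      proof (cases "i = Suc N")
        case True
        then show ?thesis
          using lc by (simp add: b_def deg)
      next
        case False
        then show ?thesis
          using \<open>N < i\<close> Suc.prems by (simp add: coeff_eq_0 deg)
      qed
    qed
    then obtain a where a: "q - smult b (P (Suc N)) = (\<Sum>n\<le>N. smult (a n) (P n))"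
      using Suc.IH by blast
    have "q = (\<Sum>n\<le>Suc N. smult ((a(Suc N := b)) n) (P n))"
      using a by (simp add: algebra_simps)
    then show ?case
      by (rule exI[of _ "a(Suc N := b)"])
  qed
  then show thesis
    using that by blast
qed

locale gibbs_orthonormal =
  fixes \<phi> :: "real poly" and P :: "nat \<Rightarrow> real poly"
  assumes admissible: "admissible_potential \<phi>"
    and orthonormal: "orthonormal_polys (gibbs_density \<phi>) P"
begin

definition gibbs_mean :: "real poly \<Rightarrow> real" where
  "gibbs_mean p = weighted_mean (gibbs_density \<phi>) (poly p)"

lemma degree_P: "degree (P n) = n"
  and P_nonzero: "P n \<noteq> 0"
  and inner_P: "weighted_inner (gibbs_density \<phi>) (poly (P n)) (poly (P l)) = (if n = l then 1 else 0)"
  using orthonormal unfolding orthonormal_polys_def by (auto dest: spec[of _ n])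

text \<open>Since the integral of a function that is not integrable is 0, the normalisation of \<open>P n\<close> makes
  its square integrable. By \<open>2 \<bar>P 0 * P n\<bar> \<le> (P 0)\<^sup>2 + (P n)\<^sup>2\<close> so is \<open>P 0 * P n\<close>, where \<open>P 0\<close> is
  a nonzero constant, and the \<open>P n\<close> span all polynomials.\<close>

lemma integrable_poly_gibbs: "integrable lborel (\<lambda>x. poly p x * gibbs_density \<phi> x)"
proof -
  let ?\<rho> = "gibbs_density \<phi>"
  have \<rho>_nonneg: "?\<rho> x \<ge> 0" for x
    by (simp add: gibbs_density_def)
  have meas: "(\<lambda>x. poly q x * ?\<rho> x) \<in> borel_measurable lborel" for q
  proof -
    have "continuous_on UNIV (\<lambda>x. poly q x * ?\<rho> x)"
      unfolding gibbs_density_def by (intro continuous_intros)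
    then show ?thesis
      by (simp add: borel_measurable_continuous_onI)
  qed
  have sq: "integrable lborel (\<lambda>x. poly (P n) x * poly (P n) x * ?\<rho> x)" for n
  proof (rule ccontr)
    assume "\<not> ?thesis"
    then have "weighted_inner ?\<rho> (poly (P n)) (poly (P n)) = 0"
      unfolding weighted_inner_def by (rule not_integrable_integral_eq)
    then show False
      using inner_P[of n n] by simp
  qed
  obtain d where d: "P 0 = [:d:]"
    using degree_P[of 0] by (auto elim: degree_eq_zeroE)
  have "d \<noteq> 0"
    using P_nonzero[of 0] d by auto
  have int_P: "integrable lborel (\<lambda>x. poly (P n) x * ?\<rho> x)" for n
  proof -
    have "integrable lborel (\<lambda>x. poly (P 0 * P n) x * ?\<rho> x)"
    proof (rule Bochner_Integration.integrable_bound
        [OF Bochner_Integration.integrable_add[OF sq[of 0] sq[of n]] meas AE_I2])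
      fix x
      define a b where "a = poly (P 0) x" and "b = poly (P n) x"
      have "2 * \<bar>a * b\<bar> \<le> a * a + b * b"
        using sum_squares_bound[of "\<bar>a\<bar>" "\<bar>b\<bar>"] by (simp add: abs_mult power2_eq_square)
      moreover have "0 \<le> a * a + b * b"
        by (intro add_nonneg_nonneg zero_le_square)
      ultimately have "\<bar>a * b\<bar> \<le> \<bar>a * a + b * b\<bar>"
        by linarith
      then have "\<bar>a * b\<bar> * ?\<rho> x \<le> \<bar>a * a + b * b\<bar> * ?\<rho> x"
        by (intro mult_right_mono \<rho>_nonneg)
      then show "norm (poly (P 0 * P n) x * ?\<rho> x)
          \<le> norm (poly (P 0) x * poly (P 0) x * ?\<rho> x + poly (P n) x * poly (P n) x * ?\<rho> x)"
        using \<rho>_nonneg[of x]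
        by (simp add: a_def b_def abs_mult flip: distrib_right)
    qed
    then have "integrable lborel (\<lambda>x. d * (poly (P n) x * ?\<rho> x))"
      by (simp add: d mult.assoc)
    then show ?thesis
      using \<open>d \<noteq> 0\<close> by (simp only: integrable_mult_left_iff) simp
  qed
  obtain a where a: "p = (\<Sum>n\<le>degree p. smult (a n) (P n))"
    using degree_sequence_spans[of P p "degree p"] degree_P P_nonzero by blast
  have poly_p: "poly p x = (\<Sum>n\<le>degree p. a n * poly (P n) x)" for x
    using arg_cong[OF a, of "\<lambda>q. poly q x"] by (simp add: poly_sum)
  have "integrable lborel (\<lambda>x. \<Sum>n\<le>degree p. a n * (poly (P n) x * ?\<rho> x))"
    by (intro Bochner_Integration.integrable_sum integrable_mult_right int_P)
  also have "(\<lambda>x. \<Sum>n\<le>degree p. a n * (poly (P n) x * ?\<rho> x)) = (\<lambda>x. poly p x * ?\<rho> x)"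
    by (simp add: poly_p sum_distrib_right mult.assoc)
  finally show ?thesis .
qed

lemma gibbs_mean_add: "gibbs_mean (p + q) = gibbs_mean p + gibbs_mean q"
  and gibbs_mean_diff: "gibbs_mean (p - q) = gibbs_mean p - gibbs_mean q"
  and gibbs_mean_smult: "gibbs_mean (smult c p) = c * gibbs_mean p"
  using integrable_poly_gibbs[of p] integrable_poly_gibbs[of q]
  by (simp_all add: gibbs_mean_def weighted_mean_def distrib_right left_diff_distrib mult.assoc)

lemma gibbs_mean_sum: "gibbs_mean (\<Sum>n\<in>A. f n) = (\<Sum>n\<in>A. gibbs_mean (f n))"
proof -
  have "gibbs_mean 0 = 0"
    by (simp add: gibbs_mean_def weighted_mean_def)
  then show ?thesis
    by (induction A rule: infinite_finite_induct) (simp_all add: gibbs_mean_add)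
qed

lemma inner_eq_gibbs_mean:
  "weighted_inner (gibbs_density \<phi>) (poly p) (poly q) = gibbs_mean (p * q)"
  by (simp add: weighted_inner_def gibbs_mean_def weighted_mean_def)

text \<open>Integration by parts, with one factor equal to \<open>\<rho>\<close>: \<open>(p \<rho>)' = (p' - p \<phi>') \<rho>\<close>, and \<open>p \<rho>\<close> vanishes at both ends.\<close>

lemma gibbs_mean_pderiv: "gibbs_mean (pderiv p) = gibbs_mean (p * pderiv \<phi>)"
proof -
  let ?F = "\<lambda>x. poly p x * gibbs_density \<phi> x"
  let ?f = "\<lambda>x. poly (pderiv p - p * pderiv \<phi>) x * gibbs_density \<phi> x"
  have "(LBINT x=-\<infinity>..\<infinity>. ?f x) = 0 - 0"
  proof (rule interval_integral_FTC_integrable)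
    show "(?F has_vector_derivative ?f x) (at x)" for x
      unfolding has_real_derivative_iff_has_vector_derivative[symmetric] gibbs_density_def
      by (auto intro!: derivative_eq_intros simp: algebra_simps)
    show "isCont ?f x" for x
      unfolding gibbs_density_def by (intro continuous_intros)
    show "set_integrable lborel (einterval (-\<infinity>) \<infinity>) ?f"
      using integrable_poly_gibbs[of "pderiv p - p * pderiv \<phi>"] by (simp add: set_integrable_def)
    show "((?F \<circ> real_of_ereal) \<longlongrightarrow> 0) (at_right (-\<infinity>))"
      using poly_times_gibbs_density_at_bot[OF admissible]
      by (simp add: ereal_tendsto_simps1)
    show "((?F \<circ> real_of_ereal) \<longlongrightarrow> 0) (at_left \<infinity>)"
      using poly_times_gibbs_density_at_top[OF admissible]
      by (simp add: ereal_tendsto_simps1)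
  qed simp
  then have "gibbs_mean (pderiv p - p * pderiv \<phi>) = 0"
    by (simp add: interval_lebesgue_integral_def set_lebesgue_integral_def
        gibbs_mean_def weighted_mean_def)
  then show ?thesis
    by (simp add: gibbs_mean_diff)
qed

section \<open>Weak form of the scheme\<close>

definition state :: "nat \<Rightarrow> (nat \<Rightarrow> int \<Rightarrow> nat \<Rightarrow> real) \<Rightarrow> nat \<Rightarrow> int \<Rightarrow> real poly" where
  "state N C i k = (\<Sum>n\<le>N. smult (C i k n) (P n))"

lemma poly_state: "poly (state N C i k) = hermite_coefficient P N C i k"
  by (simp add: fun_eq_iff state_def hermite_coefficient_def poly_sum)

lemma gibbs_mean_state_P:
  assumes "n \<le> N"
  shows "gibbs_mean (state N C i k * P n) = C i k n"
  using assms
  by (simp add: state_def sum_distrib_right gibbs_mean_sum gibbs_mean_smult inner_P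
      if_distrib[of "\<lambda>z. _ * z"] flip: inner_eq_gibbs_mean cong: if_cong)

text \<open>Against \<open>P n\<close> this is the scheme itself, up to integration by parts, and both sides are linear in the test polynomial.\<close>

lemma weak_form:
  assumes scheme: "fully_discrete_scheme \<phi> P H K N \<Delta>t h0 C"
    and "k \<le> K" and "degree q \<le> N"
  shows "gibbs_mean (state N C (Suc i) (int k) * q) = gibbs_mean (state N C i (int k) * q) + \<Delta>t *
      (sqrt (real k + 1) * gibbs_mean (state N C (Suc i) (int k + 1) * pderiv q)
       - sqrt (real k) * gibbs_mean (state N C (Suc i) (int k - 1) * (pderiv \<phi> * q - pderiv q))
       - (if k \<ge> 3 then 1 else 0) * gibbs_mean (state N C (Suc i) (int k) * q))"
    (is "?L q = ?R q")
proof -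
  have test_P: "?L (P n) = ?R (P n)" if "n \<le> N" for n
  proof -
    have up: "(\<Sum>r\<le>N. weighted_inner (gibbs_density \<phi>) (poly (P r)) (poly (pderiv (P n)))
          * C (Suc i) (int k + 1) r) = gibbs_mean (state N C (Suc i) (int k + 1) * pderiv (P n))"
      by (simp add: state_def sum_distrib_right gibbs_mean_sum gibbs_mean_smult
          inner_eq_gibbs_mean) (simp add: mult.commute)
    have "(\<Sum>r\<le>N. weighted_inner (gibbs_density \<phi>) (poly (P n)) (poly (pderiv (P r)))
          * C (Suc i) (int k - 1) r) = gibbs_mean (pderiv (state N C (Suc i) (int k - 1)) * P n)"
      by (simp add: state_def sum_distrib_right gibbs_mean_sum gibbs_mean_smult
          inner_eq_gibbs_mean higher_pderiv_sum[of 1, simplified] pderiv_smult) (simp add: mult.commute)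
    also have "\<dots> = gibbs_mean (pderiv (state N C (Suc i) (int k - 1) * P n))
        - gibbs_mean (state N C (Suc i) (int k - 1) * pderiv (P n))"
      by (simp add: pderiv_mult gibbs_mean_add mult.commute)
    also have "\<dots> = gibbs_mean (state N C (Suc i) (int k - 1) * (pderiv \<phi> * P n - pderiv (P n)))"
      by (simp only: gibbs_mean_pderiv flip: gibbs_mean_diff) (simp add: algebra_simps)
    finally have down: "(\<Sum>r\<le>N. weighted_inner (gibbs_density \<phi>) (poly (P n)) (poly (pderiv (P r)))
          * C (Suc i) (int k - 1) r)
        = gibbs_mean (state N C (Suc i) (int k - 1) * (pderiv \<phi> * P n - pderiv (P n)))" .
    note step = scheme[unfolded fully_discrete_scheme_def, THEN conjunct2, THEN conjunct2,
        rule_format, OF \<open>k \<le> K\<close> that, of i]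
    show ?thesis
      using step unfolding up down gibbs_mean_state_P[OF that] .
  qed
  obtain a where a: "q = (\<Sum>n\<le>N. smult (a n) (P n))"
    using degree_sequence_spans[of P q N] degree_P P_nonzero \<open>degree q \<le> N\<close> by blast
  have comb: "gibbs_mean (u * (\<Sum>n\<le>N. smult (a n) (f n))) = (\<Sum>n\<le>N. a n * gibbs_mean (u * f n))"
    for u f
    by (simp add: sum_distrib_left gibbs_mean_sum gibbs_mean_smult)
  have dq: "pderiv q = (\<Sum>n\<le>N. smult (a n) (pderiv (P n)))"
    by (simp add: a higher_pderiv_sum[of 1, simplified] pderiv_smult)
  have adj: "pderiv \<phi> * q - pderiv q = (\<Sum>n\<le>N. smult (a n) (pderiv \<phi> * P n - pderiv (P n)))"
    unfolding dq by (simp add: a sum_distrib_left smult_diff_right sum_subtractf)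
  have "?L q = (\<Sum>n\<le>N. a n * ?L (P n))"
    unfolding a by (rule comb)
  also have "\<dots> = (\<Sum>n\<le>N. a n * ?R (P n))"
    by (intro sum.cong refl arg_cong2[of _ _ _ _ "(*)"] test_P) simp
  also have "\<dots> = ?R q"
    unfolding adj unfolding dq unfolding a comb
    by (simp only: distrib_left right_diff_distrib sum.distrib sum_subtractf sum_distrib_left mult.left_commute)
  finally show ?thesis .
qed

end

section \<open>Propagation of the constraints\<close>

text \<open>An implicit Euler step for \<open>a' = \<omega> b\<close>, \<open>b' = - \<omega> a\<close> started at the origin, with the step size
  absorbed into \<open>\<omega>\<close>, returns the origin.\<close>

lemma implicit_rotation_step_zero:
  fixes a b \<omega> :: real
  assumes "a = \<omega> * b" and "b = - (\<omega> * a)"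
  shows "a = 0 \<and> b = 0"
proof -
  have "b = - (\<omega> * (\<omega> * b))"
    using assms(2) unfolding assms(1) .
  moreover have "b * (1 + \<omega>\<^sup>2) = b + \<omega> * (\<omega> * b)"
    by (simp add: algebra_simps power2_eq_square)
  ultimately have "b * (1 + \<omega>\<^sup>2) = 0"
    by linarith
  moreover have "1 + \<omega>\<^sup>2 \<noteq> 0"
    using zero_le_power2[of \<omega>] by linarith
  ultimately have "b = 0"
    by simp
  with assms(1) show ?thesis
    by simp
qed

theorem proposition4p1:
  fixes \<phi> :: "real poly"
    and P H :: "nat \<Rightarrow> real poly"
    and K N :: nat
    and \<Delta>t :: real
    and h0 :: "real \<times> real \<Rightarrow> real"
    and C :: "nat \<Rightarrow> int \<Rightarrow> nat \<Rightarrow> real"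
    and r m e :: "nat \<Rightarrow> real \<Rightarrow> real"
    and mean :: "(real \<Rightarrow> real) \<Rightarrow> real"
  assumes "admissible_potential \<phi>"
    and "orthonormal_polys (gibbs_density \<phi>) P"
    and "orthonormal_polys std_normal_density H"
    and "K \<ge> 2" and "N \<ge> degree \<phi>" and "\<Delta>t > 0"
    and "square_integrable_wrt (maxwellian \<phi>) h0"
    and "fully_discrete_scheme \<phi> P H K N \<Delta>t h0 C"
    and "r = (\<lambda>i. hermite_coefficient P N C i 0)"
    and "m = (\<lambda>i. hermite_coefficient P N C i 1)"
    and "e = (\<lambda>i. hermite_coefficient P N C i 2)"
    and "mean = weighted_mean (gibbs_density \<phi>)"
  shows
    "(mean (r 0) = 0 \<longrightarrow> (\<forall>i. mean (r i) = 0)) \<and>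
     (1 / sqrt 2 * mean (e 0) + mean (\<lambda>x. poly \<phi> x * r 0 x) = 0 \<longrightarrow>
        (\<forall>i. 1 / sqrt 2 * mean (e i) + mean (\<lambda>x. poly \<phi> x * r i x) = 0)) \<and>
     (harmonic_potential \<phi> \<longrightarrow>
       (mean (\<lambda>x. r 0 x * x) = 0 \<and> mean (m 0) = 0 \<longrightarrow>
          (\<forall>i. mean (\<lambda>x. r i x * x) = 0 \<and> mean (m i) = 0)) \<and>
       (mean (r 0) = 0 \<and> mean (\<lambda>x. m 0 x * x) = 0 \<and>
          1 / sqrt 2 * mean (e 0) - mean (\<lambda>x. poly \<phi> x * r 0 x) = 0 \<longrightarrow>
          (\<forall>i. mean (r i) = 0 \<and> mean (\<lambda>x. m i x * x) = 0 \<and>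
             1 / sqrt 2 * mean (e i) - mean (\<lambda>x. poly \<phi> x * r i x) = 0)))"
proof -
  interpret gibbs_orthonormal \<phi> P
    using assms(1,2) by unfold_locales
  note scheme = assms(8)
  let ?R = "\<lambda>i k. state N C i k"
  have \<phi>_deg: "degree \<phi> \<ge> 2"
    using assms(1) unfolding admissible_potential_def by auto
  then have N: "2 \<le> N" "degree \<phi> \<le> N"
    using assms(5) by auto
  have means: "mean (r i) = gibbs_mean (?R i 0)" "mean (m i) = gibbs_mean (?R i 1)"
    "mean (e i) = gibbs_mean (?R i 2)"
    "mean (\<lambda>x. poly \<phi> x * r i x) = gibbs_mean (?R i 0 * \<phi>)"
    "mean (\<lambda>x. r i x * x) = gibbs_mean (?R i 0 * [:0, 1:])"
    "mean (\<lambda>x. m i x * x) = gibbs_mean (?R i 1 * [:0, 1:])" for i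
    by (simp_all add: assms(9-12) gibbs_mean_def weighted_mean_def mult_ac flip: poly_state)
  have zero: "gibbs_mean 0 = 0"
    by (simp add: gibbs_mean_def weighted_mean_def)
  have mass: "gibbs_mean (?R (Suc i) 0) = gibbs_mean (?R i 0)" for i
    using weak_form[OF scheme, of 0 1 i] by (simp add: zero)
  have potential: "gibbs_mean (?R (Suc i) 0 * \<phi>) =
      gibbs_mean (?R i 0 * \<phi>) + \<Delta>t * gibbs_mean (?R (Suc i) 1 * pderiv \<phi>)" for i
    using weak_form[OF scheme, of 0 \<phi> i] N by simp
  have level2: "gibbs_mean (?R (Suc i) 2) =
      gibbs_mean (?R i 2) - \<Delta>t * (sqrt 2 * gibbs_mean (?R (Suc i) 1 * pderiv \<phi>))" for i
    using weak_form[OF scheme, of 2 1 i] assms(4) by (simp add: zero)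
  have kinetic: "1 / sqrt 2 * gibbs_mean (?R (Suc i) 2) =
      1 / sqrt 2 * gibbs_mean (?R i 2) - \<Delta>t * gibbs_mean (?R (Suc i) 1 * pderiv \<phi>)" for i
    unfolding level2 by (simp add: field_simps)
  have mass_const: "gibbs_mean (?R i 0) = gibbs_mean (?R 0 0)" for i
    by (induction i) (simp_all add: mass)
  have energy_const: "1 / sqrt 2 * gibbs_mean (?R i 2) + gibbs_mean (?R i 0 * \<phi>) =
      1 / sqrt 2 * gibbs_mean (?R 0 2) + gibbs_mean (?R 0 0 * \<phi>)" for i
  proof (induction i)
    case (Suc i)
    then show ?case
      unfolding kinetic potential by linarith
  qed simp
  have harmonic: "\<phi> = [:ln (2 * pi) / 2, 0, 1 / 2:]" "pderiv \<phi> = [:0, 1:]"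
    if "harmonic_potential \<phi>"
  proof -
    show "\<phi> = [:ln (2 * pi) / 2, 0, 1 / 2:]"
      using that unfolding harmonic_potential_def
      by (simp add: fun_eq_iff power2_eq_square field_simps flip: poly_eq_poly_eq_iff)
    then show "pderiv \<phi> = [:0, 1:]"
      by (simp add: pderiv_pCons)
  qed
  have first: "(\<forall>i. gibbs_mean (?R i 0 * [:0, 1:]) = 0 \<and> gibbs_mean (?R i 1) = 0)"
    if "harmonic_potential \<phi>"
      and init: "gibbs_mean (?R 0 0 * [:0, 1:]) = 0 \<and> gibbs_mean (?R 0 1) = 0"
  proof
    fix i
    note d\<phi> = harmonic(2)[OF that(1)]
    show "gibbs_mean (?R i 0 * [:0, 1:]) = 0 \<and> gibbs_mean (?R i 1) = 0"
    proof (induction i)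
      case (Suc i)
      have "gibbs_mean (?R (Suc i) 0 * [:0, 1:]) = \<Delta>t * gibbs_mean (?R (Suc i) 1)"
        using weak_form[OF scheme, of 0 "[:0, 1:]" i] N Suc
        by (simp add: pderiv_pCons flip: one_pCons)
      moreover have "gibbs_mean (?R (Suc i) 1) = - (\<Delta>t * gibbs_mean (?R (Suc i) 0 * [:0, 1:]))"
        using weak_form[OF scheme, of 1 1 i] assms(4) Suc by (simp add: zero d\<phi>)
      ultimately show ?case
        by (rule implicit_rotation_step_zero)
    qed (rule init)
  qed
  have second: "(\<forall>i. gibbs_mean (?R i 0) = 0 \<and> gibbs_mean (?R i 1 * [:0, 1:]) = 0 \<and>
      1 / sqrt 2 * gibbs_mean (?R i 2) - gibbs_mean (?R i 0 * \<phi>) = 0)"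
    if "harmonic_potential \<phi>"
      and init: "gibbs_mean (?R 0 0) = 0 \<and> gibbs_mean (?R 0 1 * [:0, 1:]) = 0 \<and>
        1 / sqrt 2 * gibbs_mean (?R 0 2) - gibbs_mean (?R 0 0 * \<phi>) = 0"
  proof
    fix i
    note \<phi> = harmonic(1)[OF that(1)] and d\<phi> = harmonic(2)[OF that(1)]
    have mass0: "gibbs_mean (?R i 0) = 0" for i
      using mass_const init by simp
    have "gibbs_mean (?R i 1 * [:0, 1:]) = 0 \<and>
        1 / sqrt 2 * gibbs_mean (?R i 2) - gibbs_mean (?R i 0 * \<phi>) = 0"
    proof (induction i)
      case (Suc i)
      let ?a = "gibbs_mean (?R (Suc i) 1 * [:0, 1:])"
      let ?b = "1 / sqrt 2 * gibbs_mean (?R (Suc i) 2) - gibbs_mean (?R (Suc i) 0 * \<phi>)"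
      \<comment> \<open>The polynomial tested against level 0 is \<open>x\<^sup>2 - 1\<close>, which is \<open>2 \<phi>\<close> up to a constant; the constant
        is invisible because the mass vanishes.\<close>
      have "pderiv \<phi> * [:0, 1:] - pderiv [:0, 1:] = smult 2 \<phi> - smult (ln (2 * pi) + 1) 1"
        unfolding d\<phi> by (simp add: \<phi> pderiv_pCons one_pCons)
      then have "gibbs_mean (?R (Suc i) 0 * (pderiv \<phi> * [:0, 1:] - pderiv [:0, 1:])) =
          2 * gibbs_mean (?R (Suc i) 0 * \<phi>)"
        using mass0[of "Suc i"]
        by (simp add: right_diff_distrib gibbs_mean_diff gibbs_mean_smult)
      moreover have "?a = \<Delta>t * (sqrt 2 * gibbs_mean (?R (Suc i) 2)
          - gibbs_mean (?R (Suc i) 0 * (pderiv \<phi> * [:0, 1:] - pderiv [:0, 1:])))"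
        using weak_form[OF scheme, of 1 "[:0, 1:]" i] N assms(4) Suc
        by (simp add: pderiv_pCons flip: one_pCons)
      moreover have "sqrt 2 * y = 2 * (1 / sqrt 2 * y)" for y :: real
        by (simp add: real_div_sqrt flip: times_divide_eq_left)
      ultimately have "?a = (2 * \<Delta>t) * ?b"
        by (simp only: right_diff_distrib) (simp add: algebra_simps)
      moreover have "?b = - ((2 * \<Delta>t) * ?a)"
        using Suc kinetic[of i] potential[of i] unfolding d\<phi> by linarith
      ultimately show ?case
        by (rule implicit_rotation_step_zero)
    qed (use init in simp)
    then show "gibbs_mean (?R i 0) = 0 \<and> gibbs_mean (?R i 1 * [:0, 1:]) = 0 \<and>
        1 / sqrt 2 * gibbs_mean (?R i 2) - gibbs_mean (?R i 0 * \<phi>) = 0"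
      using mass0 by blast
  qed
  show ?thesis
    unfolding means
  proof (intro conjI impI)
    show "\<forall>i. gibbs_mean (?R i 0) = 0" if "gibbs_mean (?R 0 0) = 0"
      using that mass_const by simp
    show "\<forall>i. 1 / sqrt 2 * gibbs_mean (?R i 2) + gibbs_mean (?R i 0 * \<phi>) = 0"
      if "1 / sqrt 2 * gibbs_mean (?R 0 2) + gibbs_mean (?R 0 0 * \<phi>) = 0"
      using that energy_const by simp
  qed (rule first second; assumption)+
qed

end
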